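(* Let $\mathcal H$ be a real Hilbert space and let $C_1,C_2,\dots,C_N\subseteq\mathcal H$ be closed affine subspaces with nonempty intersection $\bigcap_{i=1}^N C_i\neq\emptyset$. Let $T_{[C_1\,C_2\,\dots\,C_N]}:\mathcal H\to\mathcal H$ be the cyclic Douglas--Rachford operator. Then, for any $x_0\in\mathcal H$, $$\lim_{n\to\infty}T_{[C_1\,C_2\,\dots\,C_N]}^n x_0=P_{\operatorname{Fix} T_{[C_1\,C_2\,\dots\,C_N]}}x_0,$$ where the convergence is in norm.
   Context: For a nonempty closed convex set $C\subseteq\mathcal H$, $P_C:\mathcal H\to C$ denotes the nearest point projection onto $C$, and $R_C:=2P_C-I$ is the reflection about $C$, where $I$ is the identity operator. For nonempty closed convex $A,B\subseteq\mathcal H$, the $2$-set Douglas--Rachford operator is $T_{A,B}:=\frac{1}{2}(I+R_BR_A)$, where products of operators denote composition. The cyclic Douglas--Rachford operator is $$T_{[C_1\,C_2\,\dots\,C_N]}:=T_{C_N,C_1}\,T_{C_{N-1},C_N}\cdots T_{C_2,C_3}\,T_{C_1,C_2},$$ that is, $T_{C_1,C_2}$ is applied first and $T_{C_N,C_1}$ last. For $T:\mathcal H\to\mathcal H$, $\operatorname{Fix} T:=\{x\in\mathcal H: Tx=x\}$. *)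

theory Defs
  imports "HOL-Analysis.Analysis"
begin

text \<open>The library constant \<^const>\<open>closest_point\<close> requires a Heine-Borel, hence
  finite-dimensional, space; this is its counterpart for general Hilbert spaces. It is only
  meaningful when the nearest point exists uniquely, in particular for nonempty closed convex
  sets, as shown below.\<close>

definition proj :: "'a::{real_inner,complete_space} set \<Rightarrow> 'a \<Rightarrow> 'a" where
  "proj C x = (THE p. p \<in> C \<and> (\<forall>y\<in>C. dist x p \<le> dist x y))"

definition reflection :: "'a::{real_inner,complete_space} set \<Rightarrow> 'a \<Rightarrow> 'a" where
  "reflection C x = 2 *\<^sub>R proj C x - x"

definition DR :: "'a::{real_inner,complete_space} set \<Rightarrow> 'a set \<Rightarrow> 'a \<Rightarrow> 'a" where
  "DR A B x = (1/2) *\<^sub>R (x + reflection B (reflection A x))"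

text \<open>Only the values \<open>C 1, \<dots>, C N\<close> matter. \<^const>\<open>fold\<close> applies the operator for
  \<open>i = 1\<close> first and the one for \<open>i = N\<close> last.\<close>

definition cyclic_DR :: "nat \<Rightarrow> (nat \<Rightarrow> 'a::{real_inner,complete_space} set) \<Rightarrow> 'a \<Rightarrow> 'a" where
  "cyclic_DR N C = fold (\<lambda>i. DR (C i) (C (if i = N then 1 else i + 1))) [1..<N + 1]"

definition Fix :: "('a \<Rightarrow> 'a) \<Rightarrow> 'a set" where
  "Fix T = {x. T x = x}"

lemma nearest_points_close:
  fixes C :: "'a::real_inner set"
  assumes "convex C" "a \<in> C" "b \<in> C"
    and lower: "\<And>y. y \<in> C \<Longrightarrow> d \<le> dist x y" and "0 \<le> d"
    and "dist x a \<le> d + e" "dist x b \<le> d + e"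
  shows "(dist a b)\<^sup>2 \<le> 4 * ((d + e)\<^sup>2 - d\<^sup>2)"
proof -
  let ?m = "(1/2) *\<^sub>R a + (1/2) *\<^sub>R b"
  have "?m \<in> C"
    using assms(1-3) by (intro convexD) auto
  then have "d\<^sup>2 \<le> (dist x ?m)\<^sup>2"
    using lower \<open>0 \<le> d\<close> by (intro power_mono) auto
  moreover have "(dist x a)\<^sup>2 \<le> (d + e)\<^sup>2" "(dist x b)\<^sup>2 \<le> (d + e)\<^sup>2"
    using assms by (auto intro!: power_mono)
  moreover have "(dist a b)\<^sup>2 = 2 * (dist x a)\<^sup>2 + 2 * (dist x b)\<^sup>2 - 4 * (dist x ?m)\<^sup>2"
    by (simp add: dist_norm power2_norm_eq_inner inner_simps inner_commute algebra_simps)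
  ultimately show ?thesis
    by (smt (verit))
qed

lemma nearest_point_ex1:
  fixes C :: "'a::{real_inner,complete_space} set"
  assumes "closed C" "convex C" "C \<noteq> {}"
  shows "\<exists>!p. p \<in> C \<and> (\<forall>y\<in>C. dist x p \<le> dist x y)"
proof -
  define d where "d = infdist x C"
  have lower: "d \<le> dist x y" if "y \<in> C" for y
    using that by (simp add: d_def infdist_le)
  have d0: "0 \<le> d"
    by (simp add: d_def infdist_nonneg)
  have "\<exists>y\<in>C. dist x y \<le> d + inverse (real (Suc n))" for n
  proof (rule ccontr)
    assume "\<not> ?thesis"
    then have "d + inverse (real (Suc n)) \<le> infdist x C"
      unfolding infdist_notempty[OF assms(3)]
      using assms(3) by (intro cINF_greatest) auto
    then show False by (simp add: d_def)
  qed
  then obtain y where yC: "\<And>n. y n \<in> C"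
    and yd: "\<And>n. dist x (y n) \<le> d + inverse (real (Suc n))" by metis
  have lim: "(\<lambda>n. 4 * ((d + inverse (real (Suc n)))\<^sup>2 - d\<^sup>2)) \<longlonglongrightarrow> 4 * ((d + 0)\<^sup>2 - d\<^sup>2)"
    by (intro tendsto_intros LIMSEQ_inverse_real_of_nat)
  have "Cauchy y"
  proof (rule metric_CauchyI)
    fix e :: real assume "0 < e"
    then have "\<forall>\<^sub>F n in sequentially. 4 * ((d + inverse (real (Suc n)))\<^sup>2 - d\<^sup>2) < e\<^sup>2"
      using lim by (intro order_tendstoD(2)[OF lim]) auto
    then obtain k where k: "4 * ((d + inverse (real (Suc k)))\<^sup>2 - d\<^sup>2) < e\<^sup>2"
      by (auto simp: eventually_sequentially)
    have mono: "dist x (y n) \<le> d + inverse (real (Suc k))" if "k \<le> n" for n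
      using yd[of n] le_imp_inverse_le[of "real (Suc k)" "real (Suc n)"] that by linarith
    have "dist (y m) (y n) < e" if "k \<le> m" "k \<le> n" for m n
    proof (rule power_less_imp_less_base)
      show "(dist (y m) (y n))\<^sup>2 < e\<^sup>2"
        using nearest_points_close[OF assms(2) yC yC lower d0 mono mono] that k by fastforce
    qed (use \<open>0 < e\<close> in simp)
    then show "\<exists>M. \<forall>m\<ge>M. \<forall>n\<ge>M. dist (y m) (y n) < e" by blast
  qed
  then obtain p where p: "y \<longlonglongrightarrow> p"
    using Cauchy_convergent convergent_def by blast
  have "p \<in> C"
    using assms(1) yC p by (blast intro: closed_sequentially)
  moreover have "dist x p \<le> d + 0"
    by (rule LIMSEQ_le[OF tendsto_dist[OF tendsto_const p]
          tendsto_add[OF tendsto_const LIMSEQ_inverse_real_of_nat]]) (use yd in auto)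
  moreover have "p = q" if "p \<in> C" "dist x p \<le> d" "q \<in> C" "\<forall>z\<in>C. dist x q \<le> dist x z" for q
  proof -
    have "dist x q \<le> d" using that by force
    then show ?thesis
      using nearest_points_close[OF assms(2) that(1,3) lower d0, of 0] that(2) by simp
  qed
  ultimately show ?thesis
    using lower by (metis add.right_neutral order_trans)
qed

lemma proj_nearest:
  assumes "closed C" "convex C" "C \<noteq> {}"
  shows "proj C x \<in> C" and "y \<in> C \<Longrightarrow> dist x (proj C x) \<le> dist x y"
  using theI'[OF nearest_point_ex1[OF assms, of x]] unfolding proj_def by auto

end

theory Submission
  imports Defs
begin

text \<open>Around a point z of the intersection every Douglas--Rachford operator becomes a linear map
  L with norm (x - L x)^2 \<le> K (norm x^2 - norm (L x)^2), and this property is stable under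
  composition. It makes L nonexpansive and asymptotically regular: iterating, norm (L^n x)
  decreases, hence L^n x - L^(n+1) x tends to 0. By nonexpansiveness, Fix L is the orthogonal
  complement of the range of I - L; on the closure of that range L^n tends to 0, so L^n tends
  to the orthogonal projection onto Fix L.\<close>

section \<open>Projections onto closed affine subspaces\<close>

text \<open>First-order optimality without derivatives: \<open>t^2 * b - t * a\<close> has a minimum
  at t = 0, so its slope there vanishes. It serves wherever an inequality holds along a whole line,
  for both signs of t.\<close>

lemma linear_le_quadratic_imp_zero:
  fixes a b :: real
  assumes "\<And>t. t * a \<le> t\<^sup>2 * b"
  shows "a = 0"
proof (rule ccontr)
  assume "a \<noteq> 0"
  \<comment> \<open>Positive with \<open>s * b < 1\<close> for either sign of b; testing at
    \<open>t = s * a\<close> makes the linear term beat the quadratic one.\<close>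
  define s where "s = 1 / (\<bar>b\<bar> + 1)"
  have s: "s > 0" "s * b < 1"
    by (auto simp: s_def field_simps)
  have "s * a\<^sup>2 \<le> s * (a\<^sup>2 * (s * b))"
    using assms[of "s * a"] by (simp add: power2_eq_square algebra_simps)
  then have "a\<^sup>2 \<le> a\<^sup>2 * (s * b)"
    using s(1) by simp
  moreover have "a\<^sup>2 * (s * b) < a\<^sup>2 * 1"
    using s(2) \<open>a \<noteq> 0\<close> by (intro mult_strict_left_mono) auto
  ultimately show False by simp
qed

lemma norm_add_scaleR_squared:
  fixes a b :: "'a::real_inner"
  shows "(norm (a + t *\<^sub>R b))\<^sup>2 = (norm a)\<^sup>2 + 2 * t * inner a b + t\<^sup>2 * (norm b)\<^sup>2"
  unfolding power2_norm_eq_inner inner_add_left inner_add_right inner_scaleR_left inner_scaleR_right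
  by (simp add: inner_commute power2_eq_square algebra_simps)

text \<open>The obtuse-angle condition gives the Pythagorean inequality \<open>*\<close>, which
  yields both minimality and uniqueness of q.\<close>

lemma proj_eqI:
  assumes "q \<in> C" and orth: "\<And>y. y \<in> C \<Longrightarrow> inner (x - q) (y - q) \<le> 0"
  shows "proj C x = q"
proof -
  have *: "(dist x q)\<^sup>2 + (dist q y)\<^sup>2 \<le> (dist x y)\<^sup>2" if "y \<in> C" for y
  proof -
    have "(dist x y)\<^sup>2 = (dist x q)\<^sup>2 + (dist q y)\<^sup>2 - 2 * inner (x - q) (y - q)"
      by (simp add: dist_norm power2_norm_eq_inner inner_simps inner_commute algebra_simps)
    then show ?thesis using orth[OF that] by simp
  qed
  show ?thesis
    unfolding proj_def
  proof (rule the_equality)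
    have "dist x q \<le> dist x y" if "y \<in> C" for y
    proof (rule power2_le_imp_le)
      show "(dist x q)\<^sup>2 \<le> (dist x y)\<^sup>2"
        using *[OF that] zero_le_power2[of "dist q y"] by linarith
    qed simp
    then show "q \<in> C \<and> (\<forall>y\<in>C. dist x q \<le> dist x y)"
      using \<open>q \<in> C\<close> by blast
  next
    fix p assume p: "p \<in> C \<and> (\<forall>y\<in>C. dist x p \<le> dist x y)"
    then have "(dist x p)\<^sup>2 \<le> (dist x q)\<^sup>2"
      using \<open>q \<in> C\<close> by (intro power_mono) auto
    then have "(dist q p)\<^sup>2 \<le> 0"
      using *[of p] p by linarith
    then show "p = q" by simp
  qed
qed

text \<open>The line through \<open>proj A x\<close> and y stays in A, so the nearest point may be
  perturbed in both directions and the variational inequality becomes an equality.\<close>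

lemma proj_affine_orthogonal:
  assumes "closed A" "affine A" "y \<in> A"
  shows "inner (x - proj A x) (y - proj A x) = 0"
proof -
  let ?p = "proj A x"
  have near: "?p \<in> A" "\<And>w. w \<in> A \<Longrightarrow> dist x ?p \<le> dist x w"
    using proj_nearest[OF assms(1) affine_imp_convex[OF assms(2)]] assms(3) by auto
  have "t * (2 * inner (x - ?p) (y - ?p)) \<le> t\<^sup>2 * (norm (y - ?p))\<^sup>2" for t
  proof -
    have "(1 - t) *\<^sub>R ?p + t *\<^sub>R y \<in> A"
      using assms near(1) by (intro mem_affine) auto
    then have "(dist x ?p)\<^sup>2 \<le> (dist x ((1 - t) *\<^sub>R ?p + t *\<^sub>R y))\<^sup>2"
      using near(2) by (intro power_mono) auto
    also have "(1 - t) *\<^sub>R ?p + t *\<^sub>R y = ?p + t *\<^sub>R (y - ?p)"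
      by (simp add: algebra_simps)
    also have "(dist x (?p + t *\<^sub>R (y - ?p)))\<^sup>2 =
        (dist x ?p)\<^sup>2 - 2 * t * inner (x - ?p) (y - ?p) + t\<^sup>2 * (norm (y - ?p))\<^sup>2"
      using norm_add_scaleR_squared[of "x - ?p" "- t" "y - ?p"]
      by (simp add: dist_norm diff_diff_add)
    finally show ?thesis by simp
  qed
  then have "2 * inner (x - ?p) (y - ?p) = 0"
    by (rule linear_le_quadratic_imp_zero)
  then show ?thesis by simp
qed

lemma proj_affine_eqI:
  assumes "q \<in> A" and "\<And>y. y \<in> A \<Longrightarrow> inner (x - q) (y - q) = 0"
  shows "proj A x = q"
  using assms by (intro proj_eqI) auto

text \<open>With z as origin, p is the orthogonal projection onto the direction space A - z and U =
  2p - I. Since v - p v is orthogonal to p v, U preserves norms.\<close>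

lemma reflection_affine_isometry:
  assumes "closed A" "affine A" "z \<in> A"
  obtains U where "linear U" "\<And>v. norm (U v) = norm v" "\<And>x. reflection A x = z + U (x - z)"
proof
  define p where "p v = proj A (z + v) - z" for v
  define U where "U v = 2 *\<^sub>R p v - v" for v
  have pA: "z + p v \<in> A" for v
    using proj_nearest(1)[OF assms(1) affine_imp_convex[OF assms(2)]] assms(3)
    by (auto simp: p_def)
  have orth: "inner (v - p v) (y - z - p v) = 0" if "y \<in> A" for v y
    using proj_affine_orthogonal[OF assms(1,2) that, of "z + v"]
    by (simp add: p_def algebra_simps)
  have orth0: "inner (v - p v) (p v) = 0" for v
    using orth[OF assms(3), of v] by simp
  then have orth': "inner (v - p v) (y - z) = 0" if "y \<in> A" for v y
    using orth[OF that, of v] by (simp add: inner_diff_right)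
  \<comment> \<open>Membership and orthogonality to all directions determine p v, so linearity of p
    reduces to checking both for the expected values.\<close>
  have peq: "p v = w" if "z + w \<in> A" "\<And>y. y \<in> A \<Longrightarrow> inner (v - w) (y - z) = 0" for v w
  proof -
    have "proj A (z + v) = z + w"
    proof (rule proj_affine_eqI[OF that(1)])
      fix y assume "y \<in> A"
      then show "inner (z + v - (z + w)) (y - (z + w)) = 0"
        using that(2)[of y] that(2)[OF that(1)] by (simp add: inner_simps algebra_simps)
    qed
    then show ?thesis by (simp add: p_def)
  qed
  have "p (v + w) = p v + p w" for v w
  proof (rule peq)
    have "(z + p v) + (z + p w) - z \<in> A"
      using mem_affine_3_minus[OF assms(2) pA[of v] pA[of w] assms(3), of 1] by simp
    then show "z + (p v + p w) \<in> A" by (simp add: algebra_simps)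
    show "inner (v + w - (p v + p w)) (y - z) = 0" if "y \<in> A" for y
      using orth'[OF that, of v] orth'[OF that, of w]
      by (simp add: inner_diff_left inner_add_left)
  qed
  moreover have "p (c *\<^sub>R v) = c *\<^sub>R p v" for c v
  proof (rule peq)
    have "(1 - c) *\<^sub>R z + c *\<^sub>R (z + p v) \<in> A"
      by (intro mem_affine assms pA) auto
    then show "z + c *\<^sub>R p v \<in> A" by (simp add: algebra_simps)
    show "inner (c *\<^sub>R v - c *\<^sub>R p v) (y - z) = 0" if "y \<in> A" for y
      using orth'[OF that, of v] by (simp flip: scaleR_diff_right)
  qed
  ultimately show "linear U"
    by (intro linearI) (auto simp: U_def algebra_simps)
  show "norm (U v) = norm v" for v
  proof -
    have "(norm (U v))\<^sup>2 = (norm v)\<^sup>2"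
      using orth0[of v]
      by (simp add: U_def power2_norm_eq_inner inner_simps inner_commute algebra_simps)
    then show ?thesis by simp
  qed
  show "reflection A x = z + U (x - z)" for x
    by (simp add: reflection_def U_def p_def algebra_simps scaleR_2)
qed

section \<open>Affine maps attracted by their fixed points\<close>

text \<open>For linear L and K = 1 this is firm nonexpansiveness; for K > 0 it says that L is
  averaged with parameter K / (1 + K). The free constant K leaves room for composition.\<close>

definition attracting :: "real \<Rightarrow> ('a::real_inner \<Rightarrow> 'a) \<Rightarrow> bool" where
  "attracting K L \<longleftrightarrow> (\<forall>x. (norm (x - L x))\<^sup>2 \<le> K * ((norm x)\<^sup>2 - (norm (L x))\<^sup>2))"

text \<open>K is quantified inside because it grows with each composition; this keeps the induction
  along \<open>fold\<close> uniform.\<close>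

definition attracting_affine :: "'a::real_inner \<Rightarrow> ('a \<Rightarrow> 'a) \<Rightarrow> bool" where
  "attracting_affine z T \<longleftrightarrow>
    (\<exists>L K. linear L \<and> 0 < K \<and> attracting K L \<and> (\<forall>x. T x = z + L (x - z)))"

lemma attractingD:
  "attracting K L \<Longrightarrow> (norm (x - L x))\<^sup>2 \<le> K * ((norm x)\<^sup>2 - (norm (L x))\<^sup>2)"
  by (simp add: attracting_def)

lemma attracting_nonexpansive:
  assumes "attracting K L" "0 < K"
  shows "norm (L x) \<le> norm x"
proof -
  have "0 \<le> K * ((norm x)\<^sup>2 - (norm (L x))\<^sup>2)"
    by (rule order_trans[OF zero_le_power2 attractingD[OF assms(1)]])
  then have "(norm (L x))\<^sup>2 \<le> (norm x)\<^sup>2"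
    using zero_le_mult_iff[of K] assms(2) by auto
  then show ?thesis by (rule power2_le_imp_le) simp
qed

text \<open>The displacement splits as a + b, one part per factor, and the two norm drops telescope.
  Each drop is nonnegative, so both constants can be enlarged to \<open>max K J\<close>.\<close>

lemma attracting_compose:
  assumes "attracting K L" "0 < K" "attracting J M" "0 < J"
  shows "attracting (2 * max K J) (L \<circ> M)"
  unfolding attracting_def
proof
  fix x
  let ?a = "x - M x" and ?b = "M x - L (M x)"
  \<comment> \<open>Parallelogram law with the square of \<open>norm (?a - ?b)\<close>
    dropped.\<close>
  have "(norm (?a + ?b))\<^sup>2 \<le> 2 * (norm ?a)\<^sup>2 + 2 * (norm ?b)\<^sup>2"
    using zero_le_power2[of "norm (?a - ?b)"]
      norm_add_scaleR_squared[of ?a 1 ?b] norm_add_scaleR_squared[of ?a "- 1" ?b]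
    unfolding scaleR_minus_left scaleR_one add_uminus_conv_diff power2_minus power_one by linarith
  moreover have "(norm ?a)\<^sup>2 \<le> max K J * ((norm x)\<^sup>2 - (norm (M x))\<^sup>2)"
  proof -
    have "0 \<le> (norm x)\<^sup>2 - (norm (M x))\<^sup>2"
      using attracting_nonexpansive[OF assms(3,4)] by (simp add: power_mono)
    then show ?thesis
      by (intro order_trans[OF attractingD[OF assms(3)] mult_right_mono]) auto
  qed
  moreover have "(norm ?b)\<^sup>2 \<le> max K J * ((norm (M x))\<^sup>2 - (norm (L (M x)))\<^sup>2)"
  proof -
    have "0 \<le> (norm (M x))\<^sup>2 - (norm (L (M x)))\<^sup>2"
      using attracting_nonexpansive[OF assms(1,2)] by (simp add: power_mono)
    then show ?thesis
      by (intro order_trans[OF attractingD[OF assms(1)] mult_right_mono]) auto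
  qed
  ultimately have "(norm (?a + ?b))\<^sup>2 \<le> 2 * (max K J * ((norm x)\<^sup>2 - (norm (M x))\<^sup>2))
      + 2 * (max K J * ((norm (M x))\<^sup>2 - (norm (L (M x)))\<^sup>2))"
    by linarith
  also have "\<dots> = 2 * max K J * ((norm x)\<^sup>2 - (norm (L (M x)))\<^sup>2)"
    by algebra
  finally show "(norm (x - (L \<circ> M) x))\<^sup>2
      \<le> 2 * max K J * ((norm x)\<^sup>2 - (norm ((L \<circ> M) x))\<^sup>2)"
    by simp
qed

lemma attracting_affine_compose:
  assumes "attracting_affine z S" "attracting_affine z T"
  shows "attracting_affine z (S \<circ> T)"
proof -
  obtain L K where L: "linear L" "0 < K" "attracting K L" "\<And>x. S x = z + L (x - z)"
    using assms(1) unfolding attracting_affine_def by blast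
  obtain M J where M: "linear M" "0 < J" "attracting J M" "\<And>x. T x = z + M (x - z)"
    using assms(2) unfolding attracting_affine_def by blast
  have "linear (L \<circ> M)"
    by (intro linear_compose L(1) M(1))
  moreover have "0 < 2 * max K J"
    using L(2) by simp
  moreover have "attracting (2 * max K J) (L \<circ> M)"
    by (rule attracting_compose[OF L(3,2) M(3,2)])
  moreover have "\<forall>x. (S \<circ> T) x = z + (L \<circ> M) (x - z)"
    by (simp add: L(4) M(4))
  ultimately show ?thesis
    unfolding attracting_affine_def by blast
qed

lemma attracting_affine_fold:
  assumes "\<And>i. i \<in> set xs \<Longrightarrow> attracting_affine z (f i)"
  shows "attracting_affine z (fold f xs)"
  using assms
proof (induction xs)
  case Nil
  show ?case
    unfolding attracting_affine_def
    by (intro exI[of _ id] exI[of _ 1]) (auto simp: attracting_def linear_id)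
next
  case (Cons a xs)
  have "attracting_affine z (fold f xs)" "attracting_affine z (f a)"
    by (rule Cons.IH, rule Cons.prems) (simp_all add: Cons.prems)
  then have "attracting_affine z (fold f xs \<circ> f a)"
    by (rule attracting_affine_compose)
  then show ?case by (simp only: fold.simps)
qed

text \<open>Around z the operator is the average of the identity and the linear isometry V U. For
  such an average the parallelogram law gives the attracting inequality with K = 1, even with
  equality.\<close>

lemma attracting_affine_DR:
  assumes "closed A" "affine A" "z \<in> A" "closed B" "affine B" "z \<in> B"
  shows "attracting_affine z (DR A B)"
proof -
  obtain U where U: "linear U" "\<And>v. norm (U v) = norm v" "\<And>x. reflection A x = z + U (x - z)"
    using reflection_affine_isometry[OF assms(1-3)] by blast
  obtain V where V: "linear V" "\<And>v. norm (V v) = norm v" "\<And>x. reflection B x = z + V (x - z)"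
    using reflection_affine_isometry[OF assms(4-6)] by blast
  define L where "L v = (1/2) *\<^sub>R (v + V (U v))" for v
  have "linear L"
    by (intro linearI)
      (simp_all add: L_def linear_add[OF U(1)] linear_add[OF V(1)]
        linear_scale[OF U(1)] linear_scale[OF V(1)] algebra_simps)
  moreover have "attracting 1 L"
    unfolding attracting_def
  proof
    fix x
    let ?w = "V (U x)"
    have "x - L x = (1/2) *\<^sub>R (x - ?w)"
      by (simp add: L_def algebra_simps flip: scaleR_left_distrib)
    then have "(norm (x - L x))\<^sup>2 + (norm (L x))\<^sup>2
        = 1/4 * (norm (x - ?w))\<^sup>2 + 1/4 * (norm (x + ?w))\<^sup>2"
      by (simp add: L_def power_mult_distrib power2_eq_square)
    also have "\<dots> = 1/2 * (norm x)\<^sup>2 + 1/2 * (norm ?w)\<^sup>2"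
      using norm_add_scaleR_squared[of x 1 ?w, simplified]
        norm_add_scaleR_squared[of x "- 1" ?w, simplified]
      by linarith
    finally show "(norm (x - L x))\<^sup>2 \<le> 1 * ((norm x)\<^sup>2 - (norm (L x))\<^sup>2)"
      by (simp add: U(2) V(2))
  qed
  moreover have "DR A B x = z + L (x - z)" for x
  proof -
    have "(1/2) *\<^sub>R z + (1/2) *\<^sub>R z = z"
      by (simp flip: scaleR_left_distrib)
    then show ?thesis
      by (simp add: DR_def L_def U(3) V(3) algebra_simps)
  qed
  ultimately show ?thesis
    unfolding attracting_affine_def by (intro exI[of _ L] exI[of _ 1]) auto
qed

section \<open>Iteration of asymptotically regular contractions\<close>

lemma attracting_asymptotically_regular:
  assumes "attracting K L" "0 < K"
  shows "(\<lambda>n. (L ^^ n) x - (L ^^ Suc n) x) \<longlonglongrightarrow> 0"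
proof -
  let ?a = "\<lambda>n. (norm ((L ^^ n) x))\<^sup>2"
  have "decseq ?a"
    by (intro decseq_SucI power_mono) (auto simp: attracting_nonexpansive[OF assms])
  then obtain l where l: "?a \<longlonglongrightarrow> l"
    using decseq_convergent[of ?a 0] by auto
  \<comment> \<open>\<open>attracting\<close> at the point \<open>(L ^^ n) x\<close> bounds the
    squared step by this drop.\<close>
  have "(\<lambda>n. K * (?a n - ?a (Suc n))) \<longlonglongrightarrow> K * (l - l)"
    by (intro tendsto_intros l LIMSEQ_Suc[OF l])
  then have "(\<lambda>n. K * (?a n - ?a (Suc n))) \<longlonglongrightarrow> 0" by simp
  then have "(\<lambda>n. (norm ((L ^^ n) x - (L ^^ Suc n) x))\<^sup>2) \<longlonglongrightarrow> 0"
    by (rule tendsto_sandwich[OF _ _ tendsto_const, rotated -1])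
      (use assms(1) in \<open>auto simp: attracting_def\<close>)
  then have "(\<lambda>n. sqrt ((norm ((L ^^ n) x - (L ^^ Suc n) x))\<^sup>2)) \<longlonglongrightarrow> sqrt 0"
    by (rule tendsto_real_sqrt)
  then show ?thesis by (simp add: tendsto_norm_zero_iff)
qed

lemma subspace_closure:
  fixes S :: "'a::real_normed_vector set"
  assumes "subspace S"
  shows "subspace (closure S)"
proof (rule subspaceI)
  show "0 \<in> closure S"
    using subspace_0[OF assms] closure_subset by blast
  fix x y assume "x \<in> closure S" "y \<in> closure S"
  then obtain a b where "\<forall>n. a n \<in> S" "a \<longlonglongrightarrow> x" "\<forall>n. b n \<in> S" "b \<longlonglongrightarrow> y"
    unfolding closure_sequential by blast
  then show "x + y \<in> closure S"
    unfolding closure_sequential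
    by (intro exI[of _ "\<lambda>n. a n + b n"]) (auto intro: tendsto_add subspace_add[OF assms])
next
  fix c x assume "x \<in> closure S"
  then obtain a where "\<forall>n. a n \<in> S" "a \<longlonglongrightarrow> x"
    unfolding closure_sequential by blast
  then show "c *\<^sub>R x \<in> closure S"
    unfolding closure_sequential
    by (intro exI[of _ "\<lambda>n. c *\<^sub>R a n"])
      (auto intro: tendsto_scaleR subspace_scale[OF assms])
qed

context
  fixes L :: "'a::{real_inner,complete_space} \<Rightarrow> 'a"
  assumes lin: "linear L" and nonexp: "\<And>x. norm (L x) \<le> norm x"
begin

lemma linear_funpow: "linear (L ^^ n)"
proof (induction n)
  case 0
  show ?case unfolding funpow.simps by (rule linear_id)
next
  case (Suc n)
  show ?case unfolding funpow.simps by (rule linear_compose[OF Suc.IH lin])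
qed

lemma funpow_nonexpansive: "norm ((L ^^ n) x) \<le> norm x"
proof (induction n)
  case (Suc n)
  from order_trans[OF nonexp this] show ?case by simp
qed simp

text \<open>Nonexpansiveness at the perturbed point x + t y: the constant terms cancel because x is
  fixed, leaving a linear term bounded by a quadratic one for every real t.\<close>

lemma fixed_orthogonal_range:
  assumes "L x = x"
  shows "inner x (y - L y) = 0"
proof -
  have "t * (2 * inner x (L y - y)) \<le> t\<^sup>2 * ((norm y)\<^sup>2 - (norm (L y))\<^sup>2)" for t
  proof -
    have "L (x + t *\<^sub>R y) = x + t *\<^sub>R L y"
      by (simp add: linear_add[OF lin] linear_scale[OF lin] assms)
    then have "(norm (x + t *\<^sub>R L y))\<^sup>2 \<le> (norm (x + t *\<^sub>R y))\<^sup>2"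
      using nonexp[of "x + t *\<^sub>R y"] by (simp add: power_mono)
    then show ?thesis
      unfolding norm_add_scaleR_squared by (simp add: inner_diff_right algebra_simps)
  qed
  then have "2 * inner x (L y - y) = 0"
    by (rule linear_le_quadratic_imp_zero)
  then show ?thesis by (simp add: inner_diff_right)
qed

text \<open>Expanding the square of \<open>norm (L x - x)\<close> leaves only a norm difference that
  nonexpansiveness makes nonpositive. Orthogonality of x to its own displacement suffices.\<close>

lemma orthogonal_range_fixed:
  assumes "inner x (x - L x) = 0"
  shows "L x = x"
proof -
  have "(norm (L x - x))\<^sup>2 = (norm (L x))\<^sup>2 - (norm x)\<^sup>2 + 2 * inner x (x - L x)"
    by (simp add: power2_norm_eq_inner inner_simps inner_commute algebra_simps)
  also have "\<dots> \<le> 0"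
    using nonexp[of x] assms by (simp add: power_mono)
  finally show ?thesis by simp
qed

lemma funpow_tendsto_zero_closure_range:
  assumes reg: "\<And>x. (\<lambda>n. (L ^^ n) x - (L ^^ Suc n) x) \<longlonglongrightarrow> 0"
    and r: "r \<in> closure (range (\<lambda>y. y - L y))"
  shows "(\<lambda>n. (L ^^ n) r) \<longlonglongrightarrow> 0"
proof (rule LIMSEQ_I)
  fix e :: real assume "0 < e"
  then obtain y where y: "norm (r - (y - L y)) < e / 2"
    using r unfolding closure_approachable
    by (auto simp: dist_norm norm_minus_commute dest!: spec[of _ "e / 2"])
  obtain n0 where n0: "\<And>n. n0 \<le> n \<Longrightarrow> norm ((L ^^ n) y - (L ^^ Suc n) y) < e / 2"
    using LIMSEQ_D[OF reg[of y], of "e / 2"] \<open>0 < e\<close> by auto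
  have "norm ((L ^^ n) r - 0) < e" if "n0 \<le> n" for n
  proof -
    \<comment> \<open>The approximation error stays below e / 2 uniformly in n, as powers of L are
      nonexpansive; the rest is a step of the orbit of y, small by regularity.\<close>
    have "(L ^^ n) r = (L ^^ n) (r - (y - L y)) + ((L ^^ n) y - (L ^^ Suc n) y)"
      by (simp add: linear_diff[OF linear_funpow] funpow_swap1)
    also have "norm \<dots> \<le> norm (r - (y - L y)) + norm ((L ^^ n) y - (L ^^ Suc n) y)"
      by (intro norm_triangle_mono funpow_nonexpansive order_refl)
    finally show ?thesis using y n0[OF that] by simp
  qed
  then show "\<exists>n0. \<forall>n\<ge>n0. norm ((L ^^ n) r - 0) < e" by blast
qed

text \<open>This is the splitting behind von Neumann's mean ergodic theorem: x = u + r with r in the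
  closed range R of I - L and u orthogonal to R. The part u is fixed, while the powers of L send r
  to 0.\<close>

lemma funpow_tendsto_orthogonal_projection:
  assumes reg: "\<And>x. (\<lambda>n. (L ^^ n) x - (L ^^ Suc n) x) \<longlonglongrightarrow> 0"
  obtains u where "L u = u" "\<And>y. L y = y \<Longrightarrow> inner (x - u) y = 0" "(\<lambda>n. (L ^^ n) x) \<longlonglongrightarrow> u"
proof
  define R where "R = closure (range (\<lambda>y. y - L y))"
  define r where "r = proj R x"
  define u where "u = x - r"
  have "subspace (range (\<lambda>y. y - L y))"
    by (intro linear_subspace_image linear_compose_sub linear_ident lin subspace_UNIV)
  then have R: "subspace R" "closed R"
    by (auto simp: R_def intro: subspace_closure)
  have "r \<in> R"
    unfolding r_def using R subspace_0[OF R(1)]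
    by (intro proj_nearest(1) affine_imp_convex subspace_imp_affine) auto
  have "inner u (w - r) = 0" if "w \<in> R" for w
    using proj_affine_orthogonal[OF R(2) subspace_imp_affine[OF R(1)] that, of x]
    by (simp add: u_def r_def)
  moreover have "u - L u \<in> R"
    unfolding R_def by (rule subsetD[OF closure_subset]) auto
  \<comment> \<open>Taken at w = r + (u - L u), which lies in R since R is a subspace.\<close>
  ultimately have "inner u (u - L u) = 0"
    using subspace_add[OF R(1) \<open>r \<in> R\<close>] by (metis add_diff_cancel_left')
  then show Lu: "L u = u"
    by (rule orthogonal_range_fixed)
  show "inner (x - u) y = 0" if "L y = y" for y
  proof -
    \<comment> \<open>The hyperplane is closed, so orthogonality passes from the range to its
      closure.\<close>
    have "R \<subseteq> {w. inner y w = 0}"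
      unfolding R_def using fixed_orthogonal_range[OF that]
      by (intro closure_minimal closed_hyperplane) auto
    then show ?thesis
      using \<open>r \<in> R\<close> by (auto simp: u_def inner_commute)
  qed
  have "(L ^^ n) u = u" for n
    by (induction n) (auto simp: Lu)
  then have "(L ^^ n) x = u + (L ^^ n) r" for n
    using linear_add[OF linear_funpow, of n u r] by (simp add: u_def)
  moreover have "(\<lambda>n. u + (L ^^ n) r) \<longlonglongrightarrow> u + 0"
    using \<open>r \<in> R\<close> unfolding R_def
    by (intro tendsto_intros funpow_tendsto_zero_closure_range reg)
  ultimately show "(\<lambda>n. (L ^^ n) x) \<longlonglongrightarrow> u" by simp
qed

end

lemma attracting_affine_funpow_tendsto_proj_Fix:
  fixes T :: "'a::{real_inner,complete_space} \<Rightarrow> 'a"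
  assumes "attracting_affine z T"
  shows "(\<lambda>n. (T ^^ n) x) \<longlonglongrightarrow> proj (Fix T) x"
proof -
  obtain L K where L: "linear L" "0 < K" "attracting K L" "\<And>x. T x = z + L (x - z)"
    using assms unfolding attracting_affine_def by blast
  obtain u where u: "L u = u" "\<And>y. L y = y \<Longrightarrow> inner (x - z - u) y = 0"
      "(\<lambda>n. (L ^^ n) (x - z)) \<longlonglongrightarrow> u"
    using funpow_tendsto_orthogonal_projection[OF L(1) attracting_nonexpansive[OF L(3,2)]
        attracting_asymptotically_regular[OF L(3,2)], of "x - z"] by blast
  have "proj (Fix T) x = z + u"
  proof (rule proj_affine_eqI)
    show "z + u \<in> Fix T" by (simp add: Fix_def L(4) u(1))
    fix y assume "y \<in> Fix T"
    then have "L (y - z) = y - z" by (simp add: Fix_def L(4) algebra_simps)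
    \<comment> \<open>Fix T is z + Fix L, so y - (z + u) is a fixed vector of L, to which x - z - u
      is orthogonal.\<close>
    then have "L (y - z - u) = y - z - u" by (simp add: linear_diff[OF L(1)] u(1))
    from u(2)[OF this] show "inner (x - (z + u)) (y - (z + u)) = 0"
      by (simp add: algebra_simps)
  qed
  moreover have "(T ^^ n) x = z + (L ^^ n) (x - z)" for n
    by (induction n) (auto simp: L(4))
  moreover have "(\<lambda>n. z + (L ^^ n) (x - z)) \<longlonglongrightarrow> z + u"
    by (intro tendsto_intros u)
  ultimately show ?thesis by simp
qed

theorem theorem4p1:
  fixes C :: "nat \<Rightarrow> 'a::{real_inner,complete_space} set" and N :: nat and x0 :: 'a
  assumes "N \<ge> 1"
    and "\<And>i. i \<in> {1..N} \<Longrightarrow> closed (C i)"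
    and "\<And>i. i \<in> {1..N} \<Longrightarrow> affine (C i)"
    and "(\<Inter>i\<in>{1..N}. C i) \<noteq> {}"
  shows "(\<lambda>n. (cyclic_DR N C ^^ n) x0) \<longlonglongrightarrow> proj (Fix (cyclic_DR N C)) x0"
proof -
  obtain z where z: "\<And>i. i \<in> {1..N} \<Longrightarrow> z \<in> C i"
    using assms(4) by blast
  have "attracting_affine z (cyclic_DR N C)"
    unfolding cyclic_DR_def
  proof (rule attracting_affine_fold)
    fix i assume "i \<in> set [1..<N + 1]"
    \<comment> \<open>The successor of N wraps around to 1, so every factor uses two of the given
      sets, both containing z; for N = 1 the single factor is \<open>DR (C 1) (C 1)\<close>.\<close>
    then have "i \<in> {1..N}" "(if i = N then 1 else i + 1) \<in> {1..N}"
      using assms(1) by auto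
    then show "attracting_affine z (DR (C i) (C (if i = N then 1 else i + 1)))"
      by (intro attracting_affine_DR assms(2,3) z)
  qed
  then show ?thesis
    by (rule attracting_affine_funpow_tendsto_proj_Fix)
qed

end
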